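(* Let $\mathcal{K}$ be a 2-category with Eilenberg--Moore objects, $g\colon x\to y$ a 1-cell in $\mathcal{K}$, and $t$ a monad on $x$ such that the pushforward $g_\#t$ exists. Let $u^t\colon x^t\to x$ be the forgetful 1-cell from the Eilenberg--Moore object of $t$. Then $g_\#t$ is the codensity monad of $gu^t\colon x^t\to y$.
   Context: A right extension of a 1-cell $k\colon x\to z$ along $g\colon x\to y$ is a pair $(r,\varepsilon)$ with $r\colon y\to z$ and $\varepsilon\colon rg\to k$ such that for every $r'\colon y\to z$ and $\alpha\colon r'g\to k$ there is a unique $\widehat\alpha\colon r'\to r$ with $\varepsilon\cdot\widehat\alpha g=\alpha$. Pushforward: for a monad $(t,\eta^t,\mu^t)$ on $x$ and $g\colon x\to y$, $g_\#t$ is, when it exists, the right extension $(g_\#t,\varepsilon)$ of $gt$ along $g$, with the unique monad structure such that $\varepsilon\cdot\eta^{g_\#t}g=g\eta^t$ and $\varepsilon\cdot\mu^{g_\#t}g=g\mu^t\cdot\varepsilon t\cdot(g_\#t)\varepsilon$. The codensity monad of a 1-cell $k$ is $k_\#1$, the pushforward of the identity monad along $k$; like any pushforward it is determined up to isomorphism of monads. The Eilenberg--Moore object $x^t$ of a monad $t$ on $x$ is the 2-categorical limit generalising the Eilenberg--Moore category: for each 0-cell $z$, $\mathcal{K}(z,x^t)$ is isomorphic, 2-naturally in $z$, to the category of algebras for the monad $t\circ(-)$ on $\mathcal{K}(z,x)$, compatibly with the forgetful functors to $\mathcal{K}(z,x)$; $u^t$ is the universal 1-cell, and it is a right adjoint.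 *)

theory Defs
  imports Main
begin

section \<open>Strict 2-categories\<close>

text \<open>
  A 2-cell \<open>\<alpha> : f \<Rightarrow> f'\<close> has \<open>dom2 \<alpha> = f\<close> and \<open>cod2 \<alpha> = f'\<close>. All compositions are written
  in applicative order: \<open>g \<odot> f\<close> on 1-cells, \<open>\<beta> \<bullet> \<alpha>\<close> (vertical) and \<open>\<beta> \<star> \<alpha>\<close> (horizontal) on
  2-cells; their values on non-composable arguments are unspecified.
\<close>

record ('o, 'a, 'c) two_cat =
  Cell0 :: "'o set"
  Cell1 :: "'a set"
  Cell2 :: "'c set"
  src :: "'a \<Rightarrow> 'o"
  trg :: "'a \<Rightarrow> 'o"
  dom2 :: "'c \<Rightarrow> 'a"
  cod2 :: "'c \<Rightarrow> 'a"
  id1 :: "'o \<Rightarrow> 'a" ("\<one>\<index>")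
  comp1 :: "'a \<Rightarrow> 'a \<Rightarrow> 'a" (infixr "\<odot>\<index>" 75)
  id2 :: "'a \<Rightarrow> 'c" ("\<iota>\<index>")
  vcomp :: "'c \<Rightarrow> 'c \<Rightarrow> 'c" (infixr "\<bullet>\<index>" 65)
  hcomp :: "'c \<Rightarrow> 'c \<Rightarrow> 'c" (infixr "\<star>\<index>" 75)

definition hom1 :: "('o, 'a, 'c, 'm) two_cat_scheme \<Rightarrow> 'o \<Rightarrow> 'o \<Rightarrow> 'a set" where
  "hom1 K x y = {f \<in> Cell1 K. src K f = x \<and> trg K f = y}"

definition hom2 :: "('o, 'a, 'c, 'm) two_cat_scheme \<Rightarrow> 'a \<Rightarrow> 'a \<Rightarrow> 'c set" where
  "hom2 K f g = {\<alpha> \<in> Cell2 K. dom2 K \<alpha> = f \<and> cod2 K \<alpha> = g}"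

locale two_category =
  fixes K :: "('o, 'a, 'c, 'm) two_cat_scheme" (structure)
  assumes src_trg_closed: "f \<in> Cell1 K \<Longrightarrow> src K f \<in> Cell0 K \<and> trg K f \<in> Cell0 K"
    and dom2_cod2_closed: "\<alpha> \<in> Cell2 K \<Longrightarrow> dom2 K \<alpha> \<in> Cell1 K \<and> cod2 K \<alpha> \<in> Cell1 K"
    and dom2_cod2_parallel: "\<alpha> \<in> Cell2 K \<Longrightarrow>
      src K (dom2 K \<alpha>) = src K (cod2 K \<alpha>) \<and> trg K (dom2 K \<alpha>) = trg K (cod2 K \<alpha>)"
    and id1_closed: "x \<in> Cell0 K \<Longrightarrow> \<one> x \<in> hom1 K x x"
    and comp1_closed: "f \<in> hom1 K x y \<Longrightarrow> g \<in> hom1 K y z \<Longrightarrow> g \<odot> f \<in> hom1 K x z"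
    and comp1_assoc: "f \<in> hom1 K w x \<Longrightarrow> g \<in> hom1 K x y \<Longrightarrow> h \<in> hom1 K y z \<Longrightarrow>
      (h \<odot> g) \<odot> f = h \<odot> (g \<odot> f)"
    and comp1_id_left: "f \<in> hom1 K x y \<Longrightarrow> \<one> y \<odot> f = f"
    and comp1_id_right: "f \<in> hom1 K x y \<Longrightarrow> f \<odot> \<one> x = f"
    and id2_closed: "f \<in> Cell1 K \<Longrightarrow> \<iota> f \<in> hom2 K f f"
    and vcomp_closed: "\<alpha> \<in> hom2 K f g \<Longrightarrow> \<beta> \<in> hom2 K g h \<Longrightarrow> \<beta> \<bullet> \<alpha> \<in> hom2 K f h"
    and vcomp_assoc: "\<alpha> \<in> hom2 K f g \<Longrightarrow> \<beta> \<in> hom2 K g h \<Longrightarrow> \<gamma> \<in> hom2 K h k \<Longrightarrow>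
      (\<gamma> \<bullet> \<beta>) \<bullet> \<alpha> = \<gamma> \<bullet> (\<beta> \<bullet> \<alpha>)"
    and vcomp_id_left: "\<alpha> \<in> hom2 K f g \<Longrightarrow> \<iota> g \<bullet> \<alpha> = \<alpha>"
    and vcomp_id_right: "\<alpha> \<in> hom2 K f g \<Longrightarrow> \<alpha> \<bullet> \<iota> f = \<alpha>"
    and hcomp_closed: "f \<in> hom1 K x y \<Longrightarrow> g \<in> hom1 K y z \<Longrightarrow>
      \<alpha> \<in> hom2 K f f' \<Longrightarrow> \<beta> \<in> hom2 K g g' \<Longrightarrow> \<beta> \<star> \<alpha> \<in> hom2 K (g \<odot> f) (g' \<odot> f')"
    and hcomp_assoc: "f \<in> hom1 K w x \<Longrightarrow> g \<in> hom1 K x y \<Longrightarrow> h \<in> hom1 K y z \<Longrightarrow>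
      \<alpha> \<in> hom2 K f f' \<Longrightarrow> \<beta> \<in> hom2 K g g' \<Longrightarrow> \<gamma> \<in> hom2 K h h' \<Longrightarrow>
      (\<gamma> \<star> \<beta>) \<star> \<alpha> = \<gamma> \<star> (\<beta> \<star> \<alpha>)"
    and hcomp_id_left: "f \<in> hom1 K x y \<Longrightarrow> \<alpha> \<in> hom2 K f f' \<Longrightarrow> \<iota> (\<one> y) \<star> \<alpha> = \<alpha>"
    and hcomp_id_right: "f \<in> hom1 K x y \<Longrightarrow> \<alpha> \<in> hom2 K f f' \<Longrightarrow> \<alpha> \<star> \<iota> (\<one> x) = \<alpha>"
    and hcomp_id2: "f \<in> hom1 K x y \<Longrightarrow> g \<in> hom1 K y z \<Longrightarrow> \<iota> g \<star> \<iota> f = \<iota> (g \<odot> f)"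
    and interchange: "f \<in> hom1 K x y \<Longrightarrow> g \<in> hom1 K y z \<Longrightarrow>
      \<alpha> \<in> hom2 K f f' \<Longrightarrow> \<alpha>' \<in> hom2 K f' f'' \<Longrightarrow> \<beta> \<in> hom2 K g g' \<Longrightarrow> \<beta>' \<in> hom2 K g' g'' \<Longrightarrow>
      (\<beta>' \<bullet> \<beta>) \<star> (\<alpha>' \<bullet> \<alpha>) = (\<beta>' \<star> \<alpha>') \<bullet> (\<beta> \<star> \<alpha>)"

text \<open>Whiskering: \<open>g \<triangleright> \<alpha>\<close> is \<open>g\<alpha>\<close> and \<open>\<alpha> \<triangleleft> f\<close> is \<open>\<alpha>f\<close>.\<close>

abbreviation lwhisker :: "('o, 'a, 'c, 'm) two_cat_scheme \<Rightarrow> 'a \<Rightarrow> 'c \<Rightarrow> 'c" (infixr "\<triangleright>\<index>" 75)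
  where "g \<triangleright>\<^bsub>K\<^esub> \<alpha> \<equiv> \<iota>\<^bsub>K\<^esub> g \<star>\<^bsub>K\<^esub> \<alpha>"

abbreviation rwhisker :: "('o, 'a, 'c, 'm) two_cat_scheme \<Rightarrow> 'c \<Rightarrow> 'a \<Rightarrow> 'c" (infixl "\<triangleleft>\<index>" 75)
  where "\<alpha> \<triangleleft>\<^bsub>K\<^esub> f \<equiv> \<alpha> \<star>\<^bsub>K\<^esub> \<iota>\<^bsub>K\<^esub> f"

section \<open>Right extensions, monads, pushforwards\<close>

definition is_right_extension ::
  "('o, 'a, 'c, 'm) two_cat_scheme \<Rightarrow> 'o \<Rightarrow> 'o \<Rightarrow> 'o \<Rightarrow> 'a \<Rightarrow> 'a \<Rightarrow> 'a \<Rightarrow> 'c \<Rightarrow> bool" where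
  "is_right_extension K x y z g k r \<epsilon> \<longleftrightarrow>
     g \<in> hom1 K x y \<and> k \<in> hom1 K x z \<and> r \<in> hom1 K y z \<and> \<epsilon> \<in> hom2 K (r \<odot>\<^bsub>K\<^esub> g) k \<and>
     (\<forall>r' \<in> hom1 K y z. \<forall>\<alpha> \<in> hom2 K (r' \<odot>\<^bsub>K\<^esub> g) k.
        \<exists>!\<alpha>'. \<alpha>' \<in> hom2 K r' r \<and> \<epsilon> \<bullet>\<^bsub>K\<^esub> (\<alpha>' \<triangleleft>\<^bsub>K\<^esub> g) = \<alpha>)"

record ('a, 'c) monad =
  endo :: 'a
  unit :: 'c
  mult :: 'c

definition is_monad :: "('o, 'a, 'c, 'm) two_cat_scheme \<Rightarrow> 'o \<Rightarrow> ('a, 'c) monad \<Rightarrow> bool" where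
  "is_monad K x t \<longleftrightarrow>
     x \<in> Cell0 K \<and> endo t \<in> hom1 K x x \<and>
     unit t \<in> hom2 K (\<one>\<^bsub>K\<^esub> x) (endo t) \<and>
     mult t \<in> hom2 K (endo t \<odot>\<^bsub>K\<^esub> endo t) (endo t) \<and>
     mult t \<bullet>\<^bsub>K\<^esub> (endo t \<triangleright>\<^bsub>K\<^esub> unit t) = \<iota>\<^bsub>K\<^esub> (endo t) \<and>
     mult t \<bullet>\<^bsub>K\<^esub> (unit t \<triangleleft>\<^bsub>K\<^esub> endo t) = \<iota>\<^bsub>K\<^esub> (endo t) \<and>
     mult t \<bullet>\<^bsub>K\<^esub> (endo t \<triangleright>\<^bsub>K\<^esub> mult t) = mult t \<bullet>\<^bsub>K\<^esub> (mult t \<triangleleft>\<^bsub>K\<^esub> endo t)"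

definition identity_monad :: "('o, 'a, 'c, 'm) two_cat_scheme \<Rightarrow> 'o \<Rightarrow> ('a, 'c) monad" where
  "identity_monad K x = \<lparr>endo = \<one>\<^bsub>K\<^esub> x, unit = \<iota>\<^bsub>K\<^esub> (\<one>\<^bsub>K\<^esub> x), mult = \<iota>\<^bsub>K\<^esub> (\<one>\<^bsub>K\<^esub> x)\<rparr>"

text \<open>
  Pushforwards are determined only up to isomorphism of monads, so ``\<open>p\<close> is the pushforward of
  \<open>t\<close> along \<open>g\<close>'' is a relation. Given the right extension \<open>(endo p, \<epsilon>)\<close>, the unit and
  multiplication of \<open>p\<close> are forced by the last two equations.
\<close>

definition is_pushforward_via :: "('o, 'a, 'c, 'm) two_cat_scheme \<Rightarrow> 'o \<Rightarrow> 'o \<Rightarrow> 'a \<Rightarrow>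
    ('a, 'c) monad \<Rightarrow> ('a, 'c) monad \<Rightarrow> 'c \<Rightarrow> bool" where
  "is_pushforward_via K x y g t p \<epsilon> \<longleftrightarrow>
     is_monad K x t \<and> g \<in> hom1 K x y \<and>
     is_right_extension K x y y g (g \<odot>\<^bsub>K\<^esub> endo t) (endo p) \<epsilon> \<and>
     is_monad K y p \<and>
     \<epsilon> \<bullet>\<^bsub>K\<^esub> (unit p \<triangleleft>\<^bsub>K\<^esub> g) = g \<triangleright>\<^bsub>K\<^esub> unit t \<and>
     \<epsilon> \<bullet>\<^bsub>K\<^esub> (mult p \<triangleleft>\<^bsub>K\<^esub> g) =
       (g \<triangleright>\<^bsub>K\<^esub> mult t) \<bullet>\<^bsub>K\<^esub> (\<epsilon> \<triangleleft>\<^bsub>K\<^esub> endo t) \<bullet>\<^bsub>K\<^esub> (endo p \<triangleright>\<^bsub>K\<^esub> \<epsilon>)"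

definition is_pushforward :: "('o, 'a, 'c, 'm) two_cat_scheme \<Rightarrow> 'o \<Rightarrow> 'o \<Rightarrow> 'a \<Rightarrow>
    ('a, 'c) monad \<Rightarrow> ('a, 'c) monad \<Rightarrow> bool" where
  "is_pushforward K x y g t p \<longleftrightarrow> (\<exists>\<epsilon>. is_pushforward_via K x y g t p \<epsilon>)"

definition is_codensity_monad ::
  "('o, 'a, 'c, 'm) two_cat_scheme \<Rightarrow> 'o \<Rightarrow> 'o \<Rightarrow> 'a \<Rightarrow> ('a, 'c) monad \<Rightarrow> bool" where
  "is_codensity_monad K x y k p \<longleftrightarrow> is_pushforward K x y k (identity_monad K x) p"

context two_category begin

lemma hom1D: "f \<in> hom1 K x y \<Longrightarrow> f \<in> Cell1 K" by (simp add: hom1_def)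
lemma hom1_objects: "f \<in> hom1 K x y \<Longrightarrow> x \<in> Cell0 K \<and> y \<in> Cell0 K"
  using src_trg_closed by (auto simp: hom1_def)
lemma hom2_cod_hom1: "\<alpha> \<in> hom2 K f f' \<Longrightarrow> f \<in> hom1 K x y \<Longrightarrow> f' \<in> hom1 K x y"
  using dom2_cod2_closed dom2_cod2_parallel by (auto simp: hom1_def hom2_def)
lemma id2_hom2: "f \<in> hom1 K x y \<Longrightarrow> \<iota> f \<in> hom2 K f f"
  by (simp add: hom1D id2_closed)

lemma lwhisker_closed: "f \<in> hom1 K x y \<Longrightarrow> g \<in> hom1 K y z \<Longrightarrow> \<alpha> \<in> hom2 K f f' \<Longrightarrow>
   g \<triangleright> \<alpha> \<in> hom2 K (g \<odot> f) (g \<odot> f')"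
  by (rule hcomp_closed) (auto intro: id2_hom2)
lemma rwhisker_closed: "f \<in> hom1 K x y \<Longrightarrow> g \<in> hom1 K y z \<Longrightarrow> \<beta> \<in> hom2 K g g' \<Longrightarrow>
   \<beta> \<triangleleft> f \<in> hom2 K (g \<odot> f) (g' \<odot> f)"
  by (rule hcomp_closed) (auto intro: id2_hom2)
lemma lwhisker_vcomp: "f \<in> hom1 K x y \<Longrightarrow> g \<in> hom1 K y z \<Longrightarrow> \<alpha> \<in> hom2 K f f' \<Longrightarrow> \<alpha>' \<in> hom2 K f' f'' \<Longrightarrow>
   g \<triangleright> (\<alpha>' \<bullet> \<alpha>) = (g \<triangleright> \<alpha>') \<bullet> (g \<triangleright> \<alpha>)"
  using interchange[of f x y g z \<alpha> f' \<alpha>' f'' "\<iota> g" g "\<iota> g" g] by (simp add: id2_hom2 vcomp_id_left[OF id2_hom2])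
lemma rwhisker_vcomp: "f \<in> hom1 K x y \<Longrightarrow> g \<in> hom1 K y z \<Longrightarrow> \<beta> \<in> hom2 K g g' \<Longrightarrow> \<beta>' \<in> hom2 K g' g'' \<Longrightarrow>
   (\<beta>' \<bullet> \<beta>) \<triangleleft> f = (\<beta>' \<triangleleft> f) \<bullet> (\<beta> \<triangleleft> f)"
  using interchange[of f x y g z "\<iota> f" f "\<iota> f" f \<beta> g' \<beta>' g''] by (simp add: id2_hom2 vcomp_id_left[OF id2_hom2])
lemma whisker_exchange: "f \<in> hom1 K x y \<Longrightarrow> g \<in> hom1 K y z \<Longrightarrow> \<alpha> \<in> hom2 K f f' \<Longrightarrow> \<beta> \<in> hom2 K g g' \<Longrightarrow>
   (\<beta> \<triangleleft> f') \<bullet> (g \<triangleright> \<alpha>) = (g' \<triangleright> \<alpha>) \<bullet> (\<beta> \<triangleleft> f)"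
  using interchange[of f x y g z \<alpha> f' "\<iota> f'" f' "\<iota> g" g \<beta> g']
    interchange[of f x y g z "\<iota> f" f \<alpha> f' \<beta> g' "\<iota> g'" g'] hom2_cod_hom1
  by (simp add: id2_hom2[OF hom2_cod_hom1] id2_hom2 vcomp_id_left vcomp_id_right)
lemma lwhisker_comp1: "f \<in> hom1 K w x \<Longrightarrow> g \<in> hom1 K x y \<Longrightarrow> h \<in> hom1 K y z \<Longrightarrow> \<alpha> \<in> hom2 K f f' \<Longrightarrow>
   (h \<odot> g) \<triangleright> \<alpha> = h \<triangleright> (g \<triangleright> \<alpha>)"
  using hcomp_assoc[of f w x g y h z \<alpha> f' "\<iota> g" g "\<iota> h" h] hcomp_id2[of g x y h z]
  by (simp add: id2_hom2)
lemma rwhisker_comp1: "f \<in> hom1 K w x \<Longrightarrow> g \<in> hom1 K x y \<Longrightarrow> h \<in> hom1 K y z \<Longrightarrow> \<gamma> \<in> hom2 K h h' \<Longrightarrow>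
   (\<gamma> \<triangleleft> g) \<triangleleft> f = \<gamma> \<triangleleft> (g \<odot> f)"
  using hcomp_assoc[of f w x g y h z "\<iota> f" f "\<iota> g" g \<gamma> h'] hcomp_id2[of f w x g y]
  by (simp add: id2_hom2)
lemma lwhisker_rwhisker: "f \<in> hom1 K w x \<Longrightarrow> g \<in> hom1 K x y \<Longrightarrow> h \<in> hom1 K y z \<Longrightarrow> \<beta> \<in> hom2 K g g' \<Longrightarrow>
   (h \<triangleright> \<beta>) \<triangleleft> f = h \<triangleright> (\<beta> \<triangleleft> f)"
  using hcomp_assoc[of f w x g y h z "\<iota> f" f \<beta> g' "\<iota> h" h] by (simp add: id2_hom2)

text \<open>
  A right extension of \<open>g \<odot> endo t\<close> along \<open>g\<close> carries exactly one pushforward structure; in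
  particular the pushforward exists as soon as this right extension does.
\<close>

lemma right_extension_ex1_pushforward:
  assumes t: "is_monad K x t"
    and e: "is_right_extension K x y y g (g \<odot> endo t) r \<epsilon>"
  shows "\<exists>!p. endo p = r \<and> is_pushforward_via K x y g t p \<epsilon>"
proof -
  define T where "T = endo t"
  define H where "H = unit t"
  define M where "M = mult t"
  have T: "T \<in> hom1 K x x" and H: "H \<in> hom2 K (\<one> x) T" and M: "M \<in> hom2 K (T \<odot> T) T"
    and MTH: "M \<bullet> (T \<triangleright> H) = \<iota> T" and MHT: "M \<bullet> (H \<triangleleft> T) = \<iota> T"
    and MM: "M \<bullet> (T \<triangleright> M) = M \<bullet> (M \<triangleleft> T)" and x: "x \<in> Cell0 K"
    using t by (auto simp: is_monad_def T_def H_def M_def)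
  have g: "g \<in> hom1 K x y" and r: "r \<in> hom1 K y y" and \<epsilon>: "\<epsilon> \<in> hom2 K (r \<odot> g) (g \<odot> T)"
    and U: "\<And>r' \<alpha>. r' \<in> hom1 K y y \<Longrightarrow> \<alpha> \<in> hom2 K (r' \<odot> g) (g \<odot> T) \<Longrightarrow>
       \<exists>!\<alpha>'. \<alpha>' \<in> hom2 K r' r \<and> \<epsilon> \<bullet> (\<alpha>' \<triangleleft> g) = \<alpha>"
    using e by (auto simp: is_right_extension_def T_def)
  have y: "y \<in> Cell0 K" using g hom1_objects by blast
  note oney = id1_closed[OF y] and onex = id1_closed[OF x]
  note rr = comp1_closed[OF r r] and gT = comp1_closed[OF T g] and rg = comp1_closed[OF g r]
    and TT = comp1_closed[OF T T]
  note as = comp1_assoc[OF g r r] comp1_assoc[OF T g r] comp1_assoc[OF T T g] comp1_assoc[OF r r r]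
    comp1_assoc[OF T T T] comp1_assoc[OF g rr r] comp1_assoc[OF gT r r]
  have gH: "g \<triangleright> H \<in> hom2 K (\<one> y \<odot> g) (g \<odot> T)"
    using lwhisker_closed[OF onex g H] g by (simp add: comp1_id_left comp1_id_right)
  have re: "r \<triangleright> \<epsilon> \<in> hom2 K ((r \<odot> r) \<odot> g) ((r \<odot> g) \<odot> T)"
    using lwhisker_closed[OF rg r \<epsilon>] by (simp add: as)
  have eT: "\<epsilon> \<triangleleft> T \<in> hom2 K ((r \<odot> g) \<odot> T) (g \<odot> T \<odot> T)"
    using rwhisker_closed[OF T rg \<epsilon>] by (simp add: as)
  have gM: "g \<triangleright> M \<in> hom2 K (g \<odot> T \<odot> T) (g \<odot> T)"
    using lwhisker_closed[OF TT g M] .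
  define \<delta> where "\<delta> = (g \<triangleright> M) \<bullet> (\<epsilon> \<triangleleft> T) \<bullet> (r \<triangleright> \<epsilon>)"
  have \<delta>: "\<delta> \<in> hom2 K ((r \<odot> r) \<odot> g) (g \<odot> T)"
    unfolding \<delta>_def by (rule vcomp_closed[OF vcomp_closed[OF re eT] gM])
  obtain h where h: "h \<in> hom2 K (\<one> y) r" and eh: "\<epsilon> \<bullet> (h \<triangleleft> g) = g \<triangleright> H"
    using U[OF oney gH] by blast
  obtain m where m: "m \<in> hom2 K (r \<odot> r) r" and em: "\<epsilon> \<bullet> (m \<triangleleft> g) = \<delta>"
    using U[OF rr \<delta>] by blast
  have hg: "h \<triangleleft> g \<in> hom2 K g (r \<odot> g)"
    using rwhisker_closed[OF g oney h] g by (simp add: comp1_id_left)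
  have mg: "m \<triangleleft> g \<in> hom2 K (r \<odot> r \<odot> g) (r \<odot> g)"
    using rwhisker_closed[OF g rr m] by (simp add: as)
  have ir: "\<iota> r \<in> hom2 K r r" using id2_hom2[OF r] .
  have eir: "\<epsilon> \<bullet> (\<iota> r \<triangleleft> g) = \<epsilon>"
    using hcomp_id2[OF g r] vcomp_id_right[OF \<epsilon>] by simp
  have gMgTH: "(g \<triangleright> M) \<bullet> (g \<triangleright> (T \<triangleright> H)) = \<iota> (g \<odot> T)"
  proof -
    have "T \<triangleright> H \<in> hom2 K T (T \<odot> T)"
      using lwhisker_closed[OF onex T H] T by (simp add: comp1_id_right)
    from lwhisker_vcomp[OF T g this M] MTH hcomp_id2[OF T g] show ?thesis by simp
  qed
  have gMgHT: "(g \<triangleright> M) \<bullet> (g \<triangleright> (H \<triangleleft> T)) = \<iota> (g \<odot> T)"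
  proof -
    have "H \<triangleleft> T \<in> hom2 K T (T \<odot> T)"
      using rwhisker_closed[OF T onex H] T by (simp add: comp1_id_left)
    from lwhisker_vcomp[OF T g this M] MHT hcomp_id2[OF T g] show ?thesis by simp
  qed
  have rh: "r \<triangleright> h \<in> hom2 K r (r \<odot> r)"
    using lwhisker_closed[OF oney r h] r by (simp add: comp1_id_right)
  have hr: "h \<triangleleft> r \<in> hom2 K r (r \<odot> r)"
    using rwhisker_closed[OF r oney h] r by (simp add: comp1_id_left)
  have rhg: "(r \<triangleright> h) \<triangleleft> g \<in> hom2 K (r \<odot> g) (r \<odot> r \<odot> g)"
    using rwhisker_closed[OF g r rh] by (simp add: as)
  have hrg: "(h \<triangleleft> r) \<triangleleft> g \<in> hom2 K (r \<odot> g) (r \<odot> r \<odot> g)"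
    using rwhisker_closed[OF g r hr] by (simp add: as)
  have re': "r \<triangleright> \<epsilon> \<in> hom2 K (r \<odot> r \<odot> g) (r \<odot> g \<odot> T)" using re by (simp add: as)
  have eT': "\<epsilon> \<triangleleft> T \<in> hom2 K (r \<odot> g \<odot> T) (g \<odot> T \<odot> T)" using eT by (simp add: as)
  have step: "\<epsilon> \<bullet> ((m \<bullet> \<phi>) \<triangleleft> g) = (g \<triangleright> M) \<bullet> (\<epsilon> \<triangleleft> T) \<bullet> (r \<triangleright> \<epsilon>) \<bullet> (\<phi> \<triangleleft> g)"
    if s: "s \<in> hom1 K y y" and \<phi>: "\<phi> \<in> hom2 K s (r \<odot> r)" for s \<phi>
  proof -
    have pg: "\<phi> \<triangleleft> g \<in> hom2 K (s \<odot> g) (r \<odot> r \<odot> g)"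
      using rwhisker_closed[OF g s \<phi>] by (simp add: as)
    have "\<epsilon> \<bullet> ((m \<bullet> \<phi>) \<triangleleft> g) = (\<epsilon> \<bullet> (m \<triangleleft> g)) \<bullet> (\<phi> \<triangleleft> g)"
      using rwhisker_vcomp[OF g s \<phi> m] vcomp_assoc[OF pg mg \<epsilon>] by simp
    also have "\<dots> = (g \<triangleright> M) \<bullet> (\<epsilon> \<triangleleft> T) \<bullet> (r \<triangleright> \<epsilon>) \<bullet> (\<phi> \<triangleleft> g)"
      unfolding em \<delta>_def
      using vcomp_assoc[OF pg vcomp_closed[OF re' eT'] gM] vcomp_assoc[OF pg re' eT'] by simp
    finally show ?thesis .
  qed
  have ru: "m \<bullet> (r \<triangleright> h) = \<iota> r"
  proof -
    have "(r \<triangleright> \<epsilon>) \<bullet> ((r \<triangleright> h) \<triangleleft> g) = r \<triangleright> (\<epsilon> \<bullet> (h \<triangleleft> g))"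
      using lwhisker_vcomp[OF g r hg \<epsilon>] lwhisker_rwhisker[OF g oney r h] by simp
    then have 1: "(r \<triangleright> \<epsilon>) \<bullet> ((r \<triangleright> h) \<triangleleft> g) = (r \<odot> g) \<triangleright> H"
      using eh lwhisker_comp1[OF onex g r H] by simp
    have 2: "(\<epsilon> \<triangleleft> T) \<bullet> ((r \<odot> g) \<triangleright> H) = (g \<triangleright> (T \<triangleright> H)) \<bullet> \<epsilon>"
      using whisker_exchange[OF onex rg H \<epsilon>] lwhisker_comp1[OF onex T g H] hcomp_id_right[OF rg \<epsilon>] by simp
    have gTH: "g \<triangleright> (T \<triangleright> H) \<in> hom2 K (g \<odot> T) (g \<odot> T \<odot> T)"
      using lwhisker_closed[OF _ g lwhisker_closed[OF onex T H]] T by (simp add: comp1_id_right)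
    have "\<epsilon> \<bullet> ((m \<bullet> (r \<triangleright> h)) \<triangleleft> g) = \<epsilon>"
      unfolding step[OF r rh] 1 2 vcomp_assoc[OF \<epsilon> gTH gM, symmetric] gMgTH
      by (rule vcomp_id_left[OF \<epsilon>])
    then show ?thesis using U[OF r \<epsilon>] eir ir vcomp_closed[OF rh m] by metis
  qed
  have lu: "m \<bullet> (h \<triangleleft> r) = \<iota> r"
  proof -
    have "(h \<triangleleft> r) \<triangleleft> g = h \<triangleleft> (r \<odot> g)" using rwhisker_comp1[OF g r oney h] .
    moreover have "(r \<triangleright> \<epsilon>) \<bullet> (h \<triangleleft> (r \<odot> g)) = (h \<triangleleft> (g \<odot> T)) \<bullet> \<epsilon>"
      using whisker_exchange[OF rg oney \<epsilon> h] hcomp_id_left[OF rg \<epsilon>] by simp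
    moreover have "h \<triangleleft> (g \<odot> T) = (h \<triangleleft> g) \<triangleleft> T" using rwhisker_comp1[OF T g oney h] by simp
    ultimately have 1: "(r \<triangleright> \<epsilon>) \<bullet> ((h \<triangleleft> r) \<triangleleft> g) = ((h \<triangleleft> g) \<triangleleft> T) \<bullet> \<epsilon>" by simp
    have hgT: "(h \<triangleleft> g) \<triangleleft> T \<in> hom2 K (g \<odot> T) (r \<odot> g \<odot> T)"
      using rwhisker_closed[OF T g hg] by (simp add: as)
    have 2: "(\<epsilon> \<triangleleft> T) \<bullet> ((h \<triangleleft> g) \<triangleleft> T) = g \<triangleright> (H \<triangleleft> T)"
      using rwhisker_vcomp[OF T g hg \<epsilon>] eh lwhisker_rwhisker[OF T onex g H] by simp
    have gHT: "g \<triangleright> (H \<triangleleft> T) \<in> hom2 K (g \<odot> T) (g \<odot> T \<odot> T)"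
      using lwhisker_closed[OF _ g rwhisker_closed[OF T onex H]] T by (simp add: comp1_id_left)
    have "\<epsilon> \<bullet> ((m \<bullet> (h \<triangleleft> r)) \<triangleleft> g) = \<epsilon>"
      unfolding step[OF r hr] 1 vcomp_assoc[OF \<epsilon> hgT eT', symmetric] 2
        vcomp_assoc[OF \<epsilon> gHT gM, symmetric] gMgHT
      by (rule vcomp_id_left[OF \<epsilon>])
    then show ?thesis using U[OF r \<epsilon>] eir ir vcomp_closed[OF hr m] by metis
  qed
  have ass: "m \<bullet> (r \<triangleright> m) = m \<bullet> (m \<triangleleft> r)"
  proof -
    have rrr: "r \<odot> r \<odot> r \<in> hom1 K y y" using comp1_closed[OF rr r] .
    have rm: "r \<triangleright> m \<in> hom2 K (r \<odot> r \<odot> r) (r \<odot> r)" using lwhisker_closed[OF rr r m] .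
    have mr: "m \<triangleleft> r \<in> hom2 K (r \<odot> r \<odot> r) (r \<odot> r)"
      using rwhisker_closed[OF r rr m] by (simp add: as)
    have rrg: "r \<odot> r \<odot> g \<in> hom1 K x y" using comp1_closed[OF rg r] .
    have rgT: "r \<odot> g \<odot> T \<in> hom1 K x y" using comp1_closed[OF gT r] .
    have gTT: "g \<odot> T \<odot> T \<in> hom1 K x y" using comp1_closed[OF TT g] .
    have rre: "r \<triangleright> (r \<triangleright> \<epsilon>) \<in> hom2 K (r \<odot> r \<odot> r \<odot> g) (r \<odot> r \<odot> g \<odot> T)"
      by (rule lwhisker_closed[OF rrg r re'])
    have reT: "r \<triangleright> (\<epsilon> \<triangleleft> T) \<in> hom2 K (r \<odot> r \<odot> g \<odot> T) (r \<odot> g \<odot> T \<odot> T)"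
      by (rule lwhisker_closed[OF rgT r eT'])
    have rgM: "r \<triangleright> (g \<triangleright> M) \<in> hom2 K (r \<odot> g \<odot> T \<odot> T) (r \<odot> g \<odot> T)"
      by (rule lwhisker_closed[OF gTT r gM])
    have eTT: "(\<epsilon> \<triangleleft> T) \<triangleleft> T \<in> hom2 K (r \<odot> g \<odot> T \<odot> T) (g \<odot> T \<odot> T \<odot> T)"
      using rwhisker_closed[OF T _ eT'] rgT by (simp add: as comp1_assoc[OF T rgT] comp1_assoc[OF T gT r] comp1_assoc[OF T TT g])
    have gTM: "g \<triangleright> (T \<triangleright> M) \<in> hom2 K (g \<odot> T \<odot> T \<odot> T) (g \<odot> T \<odot> T)"
      by (rule lwhisker_closed[OF _ g lwhisker_closed[OF TT T M]]) (rule comp1_closed[OF TT T])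
    have gMT: "g \<triangleright> (M \<triangleleft> T) \<in> hom2 K (g \<odot> T \<odot> T \<odot> T) (g \<odot> T \<odot> T)"
      using lwhisker_closed[OF _ g rwhisker_closed[OF T TT M]] comp1_closed[OF T TT] by (simp add: as)
    have gMM: "(g \<triangleright> M) \<bullet> (g \<triangleright> (T \<triangleright> M)) = (g \<triangleright> M) \<bullet> (g \<triangleright> (M \<triangleleft> T))"
      using lwhisker_vcomp[OF comp1_closed[OF TT T] g lwhisker_closed[OF TT T M] M]
        lwhisker_vcomp[OF comp1_closed[OF T TT] g rwhisker_closed[OF T TT M] M] MM by simp
    let ?X = "((\<epsilon> \<triangleleft> T) \<triangleleft> T) \<bullet> (r \<triangleright> (\<epsilon> \<triangleleft> T)) \<bullet> (r \<triangleright> (r \<triangleright> \<epsilon>))"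
    note Y = vcomp_closed[OF rre reT] 
    note X = vcomp_closed[OF Y eTT]
    have "(r \<triangleright> \<epsilon>) \<bullet> ((r \<triangleright> m) \<triangleleft> g) = r \<triangleright> (\<epsilon> \<bullet> (m \<triangleleft> g))"
      using lwhisker_vcomp[OF rrg r mg \<epsilon>] lwhisker_rwhisker[OF g rr r m] by simp
    also have "\<dots> = (r \<triangleright> (g \<triangleright> M)) \<bullet> (r \<triangleright> (\<epsilon> \<triangleleft> T)) \<bullet> (r \<triangleright> (r \<triangleright> \<epsilon>))"
      unfolding em \<delta>_def
      using lwhisker_vcomp[OF rrg r vcomp_closed[OF re' eT'] gM] lwhisker_vcomp[OF rrg r re' eT'] by simp
    finally have A1: "(r \<triangleright> \<epsilon>) \<bullet> ((r \<triangleright> m) \<triangleleft> g) = \<dots>" .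
    have A2: "(\<epsilon> \<triangleleft> T) \<bullet> (r \<triangleright> (g \<triangleright> M)) = (g \<triangleright> (T \<triangleright> M)) \<bullet> ((\<epsilon> \<triangleleft> T) \<triangleleft> T)"
      using whisker_exchange[OF TT rg M \<epsilon>] lwhisker_comp1[OF TT g r M] lwhisker_comp1[OF TT T g M] rwhisker_comp1[OF T T rg \<epsilon>] by simp
    have "\<epsilon> \<bullet> ((m \<bullet> (r \<triangleright> m)) \<triangleleft> g) = (g \<triangleright> M) \<bullet> (g \<triangleright> (T \<triangleright> M)) \<bullet> ?X"
      unfolding step[OF rrr rm] A1 vcomp_assoc[OF Y rgM eT', symmetric] A2
        vcomp_assoc[OF Y eTT gTM] ..
    also have "\<dots> = (g \<triangleright> M) \<bullet> (g \<triangleright> (M \<triangleleft> T)) \<bullet> ?X"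
      using vcomp_assoc[OF X gTM gM] vcomp_assoc[OF X gMT gM] gMM by simp
    finally have A: "\<epsilon> \<bullet> ((m \<bullet> (r \<triangleright> m)) \<triangleleft> g) = (g \<triangleright> M) \<bullet> (g \<triangleright> (M \<triangleleft> T)) \<bullet> ?X" .
    have mrg: "(m \<triangleleft> r) \<triangleleft> g = m \<triangleleft> (r \<odot> g)" using rwhisker_comp1[OF g r rr m] .
    have B1: "(r \<triangleright> \<epsilon>) \<bullet> (m \<triangleleft> (r \<odot> g)) = ((m \<triangleleft> g) \<triangleleft> T) \<bullet> (r \<triangleright> (r \<triangleright> \<epsilon>))"
      using whisker_exchange[OF rg rr \<epsilon> m] lwhisker_comp1[OF rg r r \<epsilon>] rwhisker_comp1[OF T g rr m] by simp
    have mgT: "(m \<triangleleft> g) \<triangleleft> T \<in> hom2 K (r \<odot> r \<odot> g \<odot> T) (r \<odot> g \<odot> T)"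
      using rwhisker_closed[OF T rrg mg] by (simp add: as comp1_assoc[OF T rg r])
    have "(\<epsilon> \<triangleleft> T) \<bullet> ((m \<triangleleft> g) \<triangleleft> T) = \<delta> \<triangleleft> T"
      using rwhisker_vcomp[OF T rrg mg \<epsilon>] em by simp
    also have "\<dots> = ((g \<triangleright> M) \<triangleleft> T) \<bullet> ((\<epsilon> \<triangleleft> T) \<triangleleft> T) \<bullet> ((r \<triangleright> \<epsilon>) \<triangleleft> T)"
      unfolding \<delta>_def
      using rwhisker_vcomp[OF T rrg vcomp_closed[OF re' eT'] gM] rwhisker_vcomp[OF T rrg re' eT'] by simp
    also have "\<dots> = (g \<triangleright> (M \<triangleleft> T)) \<bullet> ((\<epsilon> \<triangleleft> T) \<triangleleft> T) \<bullet> (r \<triangleright> (\<epsilon> \<triangleleft> T))"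
      using lwhisker_rwhisker[OF T TT g M] lwhisker_rwhisker[OF T rg r \<epsilon>] by simp
    finally have B2: "(\<epsilon> \<triangleleft> T) \<bullet> ((m \<triangleleft> g) \<triangleleft> T) = \<dots>" .
    have "\<epsilon> \<bullet> ((m \<bullet> (m \<triangleleft> r)) \<triangleleft> g) = (g \<triangleright> M) \<bullet> (g \<triangleright> (M \<triangleleft> T)) \<bullet> ?X"
      unfolding step[OF rrr mr] mrg B1 vcomp_assoc[OF rre mgT eT', symmetric] B2
        vcomp_assoc[OF rre vcomp_closed[OF reT eTT] gMT] vcomp_assoc[OF rre reT eTT] ..
    with A have eq: "\<epsilon> \<bullet> ((m \<bullet> (r \<triangleright> m)) \<triangleleft> g) = \<epsilon> \<bullet> ((m \<bullet> (m \<triangleleft> r)) \<triangleleft> g)" by simp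
    have "\<epsilon> \<bullet> ((m \<bullet> (m \<triangleleft> r)) \<triangleleft> g) \<in> hom2 K ((r \<odot> r \<odot> r) \<odot> g) (g \<odot> T)"
      by (rule vcomp_closed[OF rwhisker_closed[OF g rrr vcomp_closed[OF mr m]] \<epsilon>])
    from U[OF rrr this] eq vcomp_closed[OF mr m] vcomp_closed[OF rm m]
    show ?thesis by metis
  qed
  let ?p = "\<lparr>endo = r, unit = h, mult = m\<rparr>"
  show ?thesis
  proof (rule ex1I[of _ ?p])
    show "endo ?p = r \<and> is_pushforward_via K x y g t ?p \<epsilon>"
      unfolding is_pushforward_via_def is_monad_def
      using t e eh em ru lu ass y r h m g x
      by (simp add: \<delta>_def T_def H_def M_def is_monad_def)
  next
    fix p assume p: "endo p = r \<and> is_pushforward_via K x y g t p \<epsilon>"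
    then have "unit p \<in> hom2 K (\<one> y) r" "mult p \<in> hom2 K (r \<odot> r) r"
      "\<epsilon> \<bullet> (unit p \<triangleleft> g) = g \<triangleright> H" "\<epsilon> \<bullet> (mult p \<triangleleft> g) = \<delta>"
      by (auto simp: is_pushforward_via_def is_monad_def \<delta>_def T_def H_def M_def)
    then have "unit p = h" "mult p = m"
      using U[OF oney gH] U[OF rr \<delta>] h m eh em by metis+
    with p show "p = ?p" by (cases p) auto
  qed
qed

end

section \<open>Ordinary categories and algebras\<close>

text \<open>
  Hom-sets need not be disjoint: in \<open>alg_cat\<close> a morphism of algebras is its underlying morphism.
\<close>

record ('b, 'f) cat =
  Ob :: "'b set"
  Hom :: "'b \<Rightarrow> 'b \<Rightarrow> 'f set"
  Id :: "'b \<Rightarrow> 'f"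
  Comp :: "'f \<Rightarrow> 'f \<Rightarrow> 'f"

definition is_functor :: "('b, 'f) cat \<Rightarrow> ('d, 'h) cat \<Rightarrow> ('b \<Rightarrow> 'd) \<Rightarrow> ('f \<Rightarrow> 'h) \<Rightarrow> bool" where
  "is_functor C D F0 F1 \<longleftrightarrow>
     (\<forall>a \<in> Ob C. F0 a \<in> Ob D) \<and>
     (\<forall>a \<in> Ob C. \<forall>b \<in> Ob C. \<forall>f \<in> Hom C a b. F1 f \<in> Hom D (F0 a) (F0 b)) \<and>
     (\<forall>a \<in> Ob C. F1 (Id C a) = Id D (F0 a)) \<and>
     (\<forall>a \<in> Ob C. \<forall>b \<in> Ob C. \<forall>c \<in> Ob C. \<forall>f \<in> Hom C a b. \<forall>g \<in> Hom C b c.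
        F1 (Comp C g f) = Comp D (F1 g) (F1 f))"

definition is_cat_iso :: "('b, 'f) cat \<Rightarrow> ('d, 'h) cat \<Rightarrow> ('b \<Rightarrow> 'd) \<Rightarrow> ('f \<Rightarrow> 'h) \<Rightarrow> bool" where
  "is_cat_iso C D F0 F1 \<longleftrightarrow>
     is_functor C D F0 F1 \<and> bij_betw F0 (Ob C) (Ob D) \<and>
     (\<forall>a \<in> Ob C. \<forall>b \<in> Ob C. bij_betw F1 (Hom C a b) (Hom D (F0 a) (F0 b)))"

record ('b, 'f) cat_monad =
  fun0 :: "'b \<Rightarrow> 'b"
  fun1 :: "'f \<Rightarrow> 'f"
  eta :: "'b \<Rightarrow> 'f"
  mu :: "'b \<Rightarrow> 'f"

definition alg_cat :: "('b, 'f) cat \<Rightarrow> ('b, 'f) cat_monad \<Rightarrow> ('b \<times> 'f, 'f) cat" where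
  "alg_cat C T =
     \<lparr>Ob = {(a, \<alpha>). a \<in> Ob C \<and> \<alpha> \<in> Hom C (fun0 T a) a \<and>
              Comp C \<alpha> (eta T a) = Id C a \<and>
              Comp C \<alpha> (fun1 T \<alpha>) = Comp C \<alpha> (mu T a)},
      Hom = (\<lambda>(a, \<alpha>) (b, \<beta>). {\<phi> \<in> Hom C a b. Comp C \<phi> \<alpha> = Comp C \<beta> (fun1 T \<phi>)}),
      Id = (\<lambda>(a, \<alpha>). Id C a),
      Comp = Comp C\<rparr>"

section \<open>Eilenberg--Moore objects\<close>

definition hom_cat :: "('o, 'a, 'c, 'm) two_cat_scheme \<Rightarrow> 'o \<Rightarrow> 'o \<Rightarrow> ('a, 'c) cat" where
  "hom_cat K z x = \<lparr>Ob = hom1 K z x, Hom = hom2 K, Id = id2 K, Comp = vcomp K\<rparr>"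

text \<open>The monad \<open>t \<circ> (-)\<close>, on every hom-category \<open>hom_cat K z x\<close>.\<close>

definition post_monad ::
  "('o, 'a, 'c, 'm) two_cat_scheme \<Rightarrow> ('a, 'c) monad \<Rightarrow> ('a, 'c) cat_monad" where
  "post_monad K t =
     \<lparr>fun0 = (\<lambda>a. endo t \<odot>\<^bsub>K\<^esub> a), fun1 = (\<lambda>\<phi>. endo t \<triangleright>\<^bsub>K\<^esub> \<phi>),
      eta = (\<lambda>a. unit t \<triangleleft>\<^bsub>K\<^esub> a), mu = (\<lambda>a. mult t \<triangleleft>\<^bsub>K\<^esub> a)\<rparr>"

text \<open>
  \<open>(e, u)\<close> is an Eilenberg--Moore object of \<open>t\<close> with its universal 1-cell \<open>u\<close>. The functors
  \<open>(\<Phi>0 z, \<Phi>1 z)\<close> are the components of the 2-natural isomorphism. On the algebra side, a 1-cell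
  \<open>k : w \<rightarrow> z\<close> sends an algebra \<open>(a, \<alpha>)\<close> to \<open>(ak, \<alpha>k)\<close> and a morphism \<open>\<phi>\<close> to \<open>\<phi>k\<close>, and a 2-cell
  \<open>\<kappa> : k \<Rightarrow> k'\<close> has component \<open>a\<kappa>\<close> at \<open>(a, \<alpha>)\<close>; the three clauses after \<open>is_cat_iso\<close> state
  2-naturality with respect to these. The last two clauses say that the isomorphisms carry the
  forgetful functor \<open>(a, \<alpha>) \<mapsto> a\<close> to \<open>u \<circ> (-)\<close>.
\<close>

definition is_em_object ::
  "('o, 'a, 'c, 'm) two_cat_scheme \<Rightarrow> 'o \<Rightarrow> ('a, 'c) monad \<Rightarrow> 'o \<Rightarrow> 'a \<Rightarrow> bool" where
  "is_em_object K x t e u \<longleftrightarrow>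
     e \<in> Cell0 K \<and> u \<in> hom1 K e x \<and>
     (\<exists>(\<Phi>0 :: 'o \<Rightarrow> 'a \<Rightarrow> 'a \<times> 'c) (\<Phi>1 :: 'o \<Rightarrow> 'c \<Rightarrow> 'c).
        (\<forall>z \<in> Cell0 K.
           is_cat_iso (hom_cat K z e) (alg_cat (hom_cat K z x) (post_monad K t)) (\<Phi>0 z) (\<Phi>1 z)) \<and>
        (\<forall>w \<in> Cell0 K. \<forall>z \<in> Cell0 K. \<forall>k \<in> hom1 K w z. \<forall>h \<in> hom1 K z e.
           \<Phi>0 w (h \<odot>\<^bsub>K\<^esub> k) = (fst (\<Phi>0 z h) \<odot>\<^bsub>K\<^esub> k, snd (\<Phi>0 z h) \<triangleleft>\<^bsub>K\<^esub> k)) \<and>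
        (\<forall>w \<in> Cell0 K. \<forall>z \<in> Cell0 K. \<forall>k \<in> hom1 K w z.
           \<forall>h \<in> hom1 K z e. \<forall>h' \<in> hom1 K z e. \<forall>\<theta> \<in> hom2 K h h'.
           \<Phi>1 w (\<theta> \<triangleleft>\<^bsub>K\<^esub> k) = \<Phi>1 z \<theta> \<triangleleft>\<^bsub>K\<^esub> k) \<and>
        (\<forall>w \<in> Cell0 K. \<forall>z \<in> Cell0 K. \<forall>k \<in> hom1 K w z. \<forall>k' \<in> hom1 K w z. \<forall>\<kappa> \<in> hom2 K k k'.
           \<forall>h \<in> hom1 K z e. \<Phi>1 w (h \<triangleright>\<^bsub>K\<^esub> \<kappa>) = fst (\<Phi>0 z h) \<triangleright>\<^bsub>K\<^esub> \<kappa>) \<and>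
        (\<forall>z \<in> Cell0 K. \<forall>h \<in> hom1 K z e. fst (\<Phi>0 z h) = u \<odot>\<^bsub>K\<^esub> h) \<and>
        (\<forall>z \<in> Cell0 K. \<forall>h \<in> hom1 K z e. \<forall>h' \<in> hom1 K z e. \<forall>\<theta> \<in> hom2 K h h'.
           \<Phi>1 z \<theta> = u \<triangleright>\<^bsub>K\<^esub> \<theta>))"

definition has_em_objects :: "('o, 'a, 'c, 'm) two_cat_scheme \<Rightarrow> bool" where
  "has_em_objects K \<longleftrightarrow>
     (\<forall>x t. is_monad K x t \<longrightarrow> (\<exists>e u. is_em_object K x t e u))"

end

theory Submission
  imports Defs
begin

text \<open>
  The Eilenberg--Moore object of \<open>t\<close> yields an adjunction \<open>f \<stileturn> u\<close> that generates \<open>t\<close>: \<open>f\<close> names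
  the free algebra \<open>(t, \<mu>)\<close>, and the counit \<open>c\<close> names the structure map \<open>\<alpha> : tu \<Rightarrow> u\<close> of the
  universal algebra, seen as a morphism of algebras. By the adjunction, 2-cells \<open>r'g \<Rightarrow> gt = guf\<close>
  correspond to 2-cells \<open>r'gu \<Rightarrow> gu\<close>, sending \<open>\<gamma>\<close> to \<open>g\<alpha> \<cdot> \<gamma>u\<close>. So a right extension \<open>\<epsilon>\<close> of \<open>gt\<close>
  along \<open>g\<close> becomes a right extension \<open>g\<alpha> \<cdot> \<epsilon>u\<close> of \<open>gu\<close> along \<open>gu\<close>, and the associativity
  and unit laws of \<open>\<alpha>\<close> match the two monad structures.
\<close>

context two_category begin

lemma is_monad_identity_monad:
  assumes "x \<in> Cell0 K"
  shows "is_monad K x (identity_monad K x)"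
proof -
  have 1: "\<one> x \<in> hom1 K x x" using assms by (rule id1_closed)
  have "\<iota> (\<one> x) \<in> hom2 K (\<one> x) (\<one> x)" using id2_hom2[OF 1] .
  then show ?thesis
    using assms 1
    by (simp add: is_monad_def identity_monad_def comp1_id_left[OF 1] hcomp_id2[OF 1 1]
        vcomp_id_left)
qed

text \<open>A Yoneda argument. Naturality along \<open>f\<close> identifies \<open>mult t\<close>
  with the structure map of the universal algebra whiskered by \<open>f\<close>; naturality along
  \<open>u\<close> computes the algebra named by \<open>f \<odot> u\<close>, so that the bijection
  on 2-cells can produce \<open>c\<close>. Of the two triangle identities, the one at
  \<open>u\<close> is listed; the one at \<open>f\<close>, whiskered by \<open>u\<close> on the
  left, is the monad law \<open>mult t \<bullet> (endo t \<triangleright> unit t) = \<iota> (endo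
  t)\<close>.\<close>

lemma em_object_adjunction:
  assumes t: "is_monad K x t" and em: "is_em_object K x t e u"
  obtains f c where "f \<in> hom1 K x e" and "c \<in> hom2 K (f \<odot> u) (\<one> e)"
    and "endo t = u \<odot> f" and "mult t = (u \<triangleright> c) \<triangleleft> f"
    and "(u \<triangleright> c) \<bullet> (unit t \<triangleleft> u) = \<iota> u"
proof -
  define T where "T = endo t"
  define H where "H = unit t"
  define M where "M = mult t"
  note defs = T_def H_def M_def
  have x: "x \<in> Cell0 K" and T: "T \<in> hom1 K x x" and M: "M \<in> hom2 K (T \<odot> T) T"
    and MTH: "M \<bullet> (H \<triangleleft> T) = \<iota> T" and MM: "M \<bullet> (T \<triangleright> M) = M \<bullet> (M \<triangleleft> T)"
    using t by (auto simp: is_monad_def defs)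
  let ?A = "\<lambda>z. alg_cat (hom_cat K z x) (post_monad K t)"
  obtain \<Phi>0 \<Phi>1 where e: "e \<in> Cell0 K" and u: "u \<in> hom1 K e x"
    and iso: "\<forall>z \<in> Cell0 K. is_cat_iso (hom_cat K z e) (?A z) (\<Phi>0 z) (\<Phi>1 z)"
    and nat0: "\<forall>w \<in> Cell0 K. \<forall>z \<in> Cell0 K. \<forall>k \<in> hom1 K w z. \<forall>h \<in> hom1 K z e.
       \<Phi>0 w (h \<odot> k) = (fst (\<Phi>0 z h) \<odot> k, snd (\<Phi>0 z h) \<triangleleft> k)"
    and fst0: "\<forall>z \<in> Cell0 K. \<forall>h \<in> hom1 K z e. fst (\<Phi>0 z h) = u \<odot> h"
    and \<Phi>1: "\<forall>z \<in> Cell0 K. \<forall>h \<in> hom1 K z e. \<forall>h' \<in> hom1 K z e. \<forall>\<theta> \<in> hom2 K h h'.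
       \<Phi>1 z \<theta> = u \<triangleright> \<theta>"
    using em unfolding is_em_object_def by (elim conjE exE) (rule that; assumption)
  note iso = iso[rule_format] and nat0 = nat0[rule_format] and fst0 = fst0[rule_format]
    and \<Phi>1 = \<Phi>1[rule_format]
  have 1: "\<one> e \<in> hom1 K e e" using e by (rule id1_closed)
  have bij0: "bij_betw (\<Phi>0 z) (hom1 K z e) (Ob (?A z))" if "z \<in> Cell0 K" for z
    using iso[OF that] by (simp add: is_cat_iso_def hom_cat_def)
  \<comment> \<open>The free algebra on \<open>\<one> x\<close>; its two axioms are the left unit
    law and the associativity of \<open>t\<close>.\<close>
  have "(T, M) \<in> Ob (?A x)"
    using T M MTH MM by (simp add: alg_cat_def hom_cat_def post_monad_def defs)
  then obtain f where f: "f \<in> hom1 K x e" and \<Phi>f: "\<Phi>0 x f = (T, M)"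
    using bij0[OF x] unfolding bij_betw_def by (metis imageE)
  \<comment> \<open>The identity 1-cell of \<open>e\<close> names the universal algebra, with
    underlying 1-cell \<open>u\<close>.\<close>
  define \<alpha> where "\<alpha> = snd (\<Phi>0 e (\<one> e))"
  have \<Phi>one: "\<Phi>0 e (\<one> e) = (u, \<alpha>)"
    using fst0[OF e 1] comp1_id_right[OF u] by (simp add: \<alpha>_def prod_eq_iff)
  have "(u, \<alpha>) \<in> Ob (?A e)"
    using bij_betw_apply[OF bij0[OF e] 1] \<Phi>one by simp
  then have \<alpha>: "\<alpha> \<in> hom2 K (T \<odot> u) u" and \<alpha>H: "\<alpha> \<bullet> (H \<triangleleft> u) = \<iota> u"
    and \<alpha>\<alpha>: "\<alpha> \<bullet> (T \<triangleright> \<alpha>) = \<alpha> \<bullet> (M \<triangleleft> u)"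
    by (auto simp: alg_cat_def hom_cat_def post_monad_def defs)
  have Tf: "T = u \<odot> f" using fst0[OF x f] \<Phi>f by simp
  have M\<alpha>: "M = \<alpha> \<triangleleft> f"
    using nat0[OF x e f 1] comp1_id_left[OF f] \<Phi>f \<Phi>one by simp
  have fu: "f \<odot> u \<in> hom1 K e e" using comp1_closed[OF u f] .
  have \<Phi>fu: "\<Phi>0 e (f \<odot> u) = (T \<odot> u, M \<triangleleft> u)"
    using nat0[OF e x u f] \<Phi>f by simp
  have "bij_betw (\<Phi>1 e) (hom2 K (f \<odot> u) (\<one> e)) (Hom (?A e) (T \<odot> u, M \<triangleleft> u) (u, \<alpha>))"
  proof -
    have "\<forall>a \<in> Ob (hom_cat K e e). \<forall>b \<in> Ob (hom_cat K e e).
        bij_betw (\<Phi>1 e) (Hom (hom_cat K e e) a b) (Hom (?A e) (\<Phi>0 e a) (\<Phi>0 e b))"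
      using iso[OF e] unfolding is_cat_iso_def by (elim conjE)
    from this[rule_format, of "f \<odot> u" "\<one> e"] show ?thesis
      using fu 1 unfolding \<Phi>one \<Phi>fu by (simp add: hom_cat_def)
  qed
  \<comment> \<open>The associativity law of the algebra \<open>(u, \<alpha>)\<close>, read again,
    says that \<open>\<alpha>\<close> is a morphism from the algebra of \<open>f \<odot> u\<close>
    to that of \<open>\<one> e\<close>; hence it has a preimage \<open>c\<close>.\<close>
  moreover have "\<alpha> \<in> Hom (?A e) (T \<odot> u, M \<triangleleft> u) (u, \<alpha>)"
    using \<alpha> \<alpha>\<alpha> by (simp add: alg_cat_def hom_cat_def post_monad_def defs)
  ultimately obtain c where c: "c \<in> hom2 K (f \<odot> u) (\<one> e)" and "\<Phi>1 e c = \<alpha>"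
    unfolding bij_betw_def by (metis imageE)
  then have "\<alpha> = u \<triangleright> c" using \<Phi>1[OF e fu 1] by simp
  then show thesis
    using that[OF f c] Tf M\<alpha> \<alpha>H unfolding defs by metis
qed

text \<open>Here \<open>u\<close> is a right adjoint with counit \<open>c\<close> generating
  \<open>t\<close>. Transposition along this adjunction is bijective and natural in the 1-cell being
  extended, so it carries one universal property to the other. The monad \<open>p\<close> stays
  fixed; only the 2-cell of the right extension changes.\<close>

lemma pushforward_via_right_adjoint:
  assumes f: "f \<in> hom1 K x e" and u: "u \<in> hom1 K e x" and c: "c \<in> hom2 K (f \<odot> u) (\<one> e)"
    and endo: "endo t = u \<odot> f" and mult: "mult t = (u \<triangleright> c) \<triangleleft> f"
    and triangle: "(u \<triangleright> c) \<bullet> (unit t \<triangleleft> u) = \<iota> u"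
    and push: "is_pushforward_via K x y g t p \<epsilon>"
  shows "is_pushforward_via K e y (g \<odot> u) (identity_monad K e) p
           ((g \<triangleright> (u \<triangleright> c)) \<bullet> (\<epsilon> \<triangleleft> u))"
proof -

  \<comment> \<open>The pushforward data and the action \<open>\<alpha>\<close> of the monad on
    \<open>u\<close>\<close>
  define T where "T = endo t"
  define H where "H = unit t"
  define M where "M = mult t"
  define r where "r = endo p"
  define h where "h = unit p"
  define m where "m = mult p"
  note defs = T_def H_def M_def r_def h_def m_def
  have T: "T \<in> hom1 K x x" and H: "H \<in> hom2 K (\<one> x) T" and M: "M \<in> hom2 K (T \<odot> T) T"
    and MTH: "M \<bullet> (T \<triangleright> H) = \<iota> T"
    using push by (auto simp: is_pushforward_via_def is_monad_def defs)
  have r: "r \<in> hom1 K y y" and h: "h \<in> hom2 K (\<one> y) r" and m: "m \<in> hom2 K (r \<odot> r) r"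
    and p: "is_monad K y p"
    using push by (auto simp: is_pushforward_via_def is_monad_def defs)
  have g: "g \<in> hom1 K x y" and \<epsilon>: "\<epsilon> \<in> hom2 K (r \<odot> g) (g \<odot> T)"
    and U: "\<And>r' \<alpha>. r' \<in> hom1 K y y \<Longrightarrow> \<alpha> \<in> hom2 K (r' \<odot> g) (g \<odot> T) \<Longrightarrow>
       \<exists>!\<alpha>'. \<alpha>' \<in> hom2 K r' r \<and> \<epsilon> \<bullet> (\<alpha>' \<triangleleft> g) = \<alpha>"
    and eh: "\<epsilon> \<bullet> (h \<triangleleft> g) = g \<triangleright> H"
    and em: "\<epsilon> \<bullet> (m \<triangleleft> g) = (g \<triangleright> M) \<bullet> (\<epsilon> \<triangleleft> T) \<bullet> (r \<triangleright> \<epsilon>)"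
    using push by (auto simp: is_pushforward_via_def is_right_extension_def defs)
  have e: "e \<in> Cell0 K" and x: "x \<in> Cell0 K" and y: "y \<in> Cell0 K"
    using u g hom1_objects by auto
  have 1: "\<one> e \<in> hom1 K e e" "\<one> x \<in> hom1 K x x" "\<one> y \<in> hom1 K y y"
    using e x y by (auto intro: id1_closed)
  have Tuf: "T = u \<odot> f" using endo by (simp add: defs)
  define \<alpha> where "\<alpha> = u \<triangleright> c"
  define gu where "gu = g \<odot> u"
  define \<epsilon>' where "\<epsilon>' = (g \<triangleright> \<alpha>) \<bullet> (\<epsilon> \<triangleleft> u)"
  have Tu: "T \<odot> u \<in> hom1 K e x" using comp1_closed[OF u T] .
  have fu: "f \<odot> u \<in> hom1 K e e" using comp1_closed[OF u f] .
  have gu: "gu \<in> hom1 K e y" using comp1_closed[OF u g] by (simp add: gu_def)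
  have gT: "g \<odot> T \<in> hom1 K x y" using comp1_closed[OF T g] .
  have Tu_eq: "T \<odot> u = u \<odot> f \<odot> u" by (simp add: Tuf comp1_assoc[OF u f u])
  have \<alpha>: "\<alpha> \<in> hom2 K (T \<odot> u) u"
    using lwhisker_closed[OF fu u c] by (simp add: \<alpha>_def Tu_eq comp1_id_right[OF u])
  have M\<alpha>: "M = \<alpha> \<triangleleft> f" using mult by (simp add: \<alpha>_def defs)
  have Hu: "H \<triangleleft> u \<in> hom2 K u (T \<odot> u)"
    using rwhisker_closed[OF u 1(2) H] by (simp add: comp1_id_left[OF u])
  have \<alpha>H: "\<alpha> \<bullet> (H \<triangleleft> u) = \<iota> u" using triangle by (simp add: \<alpha>_def defs)
  have g\<alpha>: "g \<triangleright> \<alpha> \<in> hom2 K (g \<odot> T \<odot> u) gu"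
    using lwhisker_closed[OF Tu g \<alpha>] by (simp add: gu_def)
  have gTu: "(g \<odot> T) \<odot> u = g \<odot> T \<odot> u" using comp1_assoc[OF u T g] .

  have \<alpha>\<alpha>: "\<alpha> \<bullet> (T \<triangleright> \<alpha>) = \<alpha> \<bullet> (M \<triangleleft> u)"
  proof -
    \<comment> \<open>Both sides are the horizontal composite \<open>c \<star> c\<close>. Whiskering
      by \<open>u\<close> on the left turns this equation into the associativity law of the
      action.\<close>
    have "c \<bullet> ((f \<odot> u) \<triangleright> c) = c \<bullet> (c \<triangleleft> (f \<odot> u))"
      using whisker_exchange[OF fu fu c c] by (simp add: hcomp_id_left[OF fu c] hcomp_id_right[OF fu c])
    moreover have fuc: "(f \<odot> u) \<triangleright> c \<in> hom2 K ((f \<odot> u) \<odot> (f \<odot> u)) (f \<odot> u)"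
      using lwhisker_closed[OF fu fu c] by (simp add: comp1_id_right[OF fu])
    moreover have cfu: "c \<triangleleft> (f \<odot> u) \<in> hom2 K ((f \<odot> u) \<odot> (f \<odot> u)) (f \<odot> u)"
      using rwhisker_closed[OF fu fu c] by (simp add: comp1_id_left[OF fu])
    ultimately have "\<alpha> \<bullet> (u \<triangleright> ((f \<odot> u) \<triangleright> c)) = \<alpha> \<bullet> (u \<triangleright> (c \<triangleleft> (f \<odot> u)))"
      unfolding \<alpha>_def
      using lwhisker_vcomp[OF comp1_closed[OF fu fu] u fuc c]
        lwhisker_vcomp[OF comp1_closed[OF fu fu] u cfu c] by simp
    moreover have "u \<triangleright> ((f \<odot> u) \<triangleright> c) = T \<triangleright> \<alpha>"
      unfolding \<alpha>_def Tuf
      using lwhisker_comp1[OF fu fu u c] lwhisker_comp1[OF fu u T c] Tu_eq Tuf by simp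
    moreover have "u \<triangleright> (c \<triangleleft> (f \<odot> u)) = M \<triangleleft> u"
      unfolding M\<alpha> \<alpha>_def
      using lwhisker_rwhisker[OF fu fu u c] rwhisker_comp1[OF u f _ \<alpha>] Tu
      by (simp add: \<alpha>_def)
    ultimately show ?thesis by simp
  qed

  \<comment> \<open>Transposition along the adjunction\<close>
  define sharp where "sharp \<gamma> = (g \<triangleright> \<alpha>) \<bullet> (\<gamma> \<triangleleft> u)" for \<gamma>
  \<comment> \<open>The inverse of \<open>sharp\<close>: whisker by \<open>f\<close>, then
    precompose with the unit of the adjunction. The 1-cell \<open>r'\<close> is an argument because
    the whiskered unit depends on it.\<close>
  define flat where "flat r' \<beta> = (\<beta> \<triangleleft> f) \<bullet> ((r' \<odot> g) \<triangleright> H)" for r' \<beta>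
  have gum: "gu \<odot> f = g \<odot> T" by (simp add: gu_def Tuf comp1_assoc[OF f u g])
  have rgT: "(s \<odot> gu) \<odot> f = (s \<odot> g) \<odot> T" if s: "s \<in> hom1 K y y" for s
    using comp1_assoc[OF f gu s] comp1_assoc[OF T g s] gum by simp
  have rgu: "s \<odot> gu = (s \<odot> g) \<odot> u" if s: "s \<in> hom1 K y y" for s
    using comp1_assoc[OF u g s] by (simp add: gu_def)
  have sharp: "sharp \<gamma> \<in> hom2 K (s \<odot> gu) gu"
    if s: "s \<in> hom1 K y y" and \<gamma>: "\<gamma> \<in> hom2 K (s \<odot> g) (g \<odot> T)" for s \<gamma>
    unfolding sharp_def rgu[OF s]
    using vcomp_closed[OF rwhisker_closed[OF u comp1_closed[OF g s] \<gamma>], unfolded gTu, OF g\<alpha>] .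
  have H': "(s \<odot> g) \<triangleright> H \<in> hom2 K (s \<odot> g) ((s \<odot> g) \<odot> T)" if s: "s \<in> hom1 K y y" for s
    using lwhisker_closed[OF 1(2) comp1_closed[OF g s] H]
    by (simp add: comp1_id_right[OF comp1_closed[OF g s]])
  have flat: "flat s \<beta> \<in> hom2 K (s \<odot> g) (g \<odot> T)"
    if s: "s \<in> hom1 K y y" and \<beta>: "\<beta> \<in> hom2 K (s \<odot> gu) gu" for s \<beta>
    unfolding flat_def
    using vcomp_closed[OF H'[OF s]] rwhisker_closed[OF f comp1_closed[OF gu s] \<beta>]
    by (simp add: gum rgT[OF s])
  have flat_sharp: "flat s (sharp \<gamma>) = \<gamma>"
    if s: "s \<in> hom1 K y y" and \<gamma>: "\<gamma> \<in> hom2 K (s \<odot> g) (g \<odot> T)" for s \<gamma>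
  proof -
    have sg: "s \<odot> g \<in> hom1 K x y" using comp1_closed[OF g s] .
    have \<gamma>T: "\<gamma> \<triangleleft> T \<in> hom2 K ((s \<odot> g) \<odot> T) (g \<odot> T \<odot> T)"
      using rwhisker_closed[OF T sg \<gamma>] by (simp add: comp1_assoc[OF T T g])
    have gM: "g \<triangleright> M \<in> hom2 K (g \<odot> T \<odot> T) (g \<odot> T)"
      using lwhisker_closed[OF comp1_closed[OF T T] g M] .
    have TH: "T \<triangleright> H \<in> hom2 K T (T \<odot> T)"
      using lwhisker_closed[OF 1(2) T H] by (simp add: comp1_id_right[OF T])
    have gTH: "(g \<odot> T) \<triangleright> H \<in> hom2 K (g \<odot> T) (g \<odot> T \<odot> T)"
      using lwhisker_closed[OF 1(2) gT H] by (simp add: comp1_id_right[OF gT] comp1_assoc[OF T T g])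
    have \<gamma>u: "\<gamma> \<triangleleft> u \<in> hom2 K ((s \<odot> g) \<odot> u) (g \<odot> T \<odot> u)"
      using rwhisker_closed[OF u sg \<gamma>] by (simp add: gTu)
    have "sharp \<gamma> \<triangleleft> f = ((g \<triangleright> \<alpha>) \<triangleleft> f) \<bullet> ((\<gamma> \<triangleleft> u) \<triangleleft> f)"
      unfolding sharp_def using rwhisker_vcomp[OF f comp1_closed[OF u sg] \<gamma>u g\<alpha>] .
    also have "\<dots> = (g \<triangleright> M) \<bullet> (\<gamma> \<triangleleft> T)"
      using lwhisker_rwhisker[OF f Tu g \<alpha>] rwhisker_comp1[OF f u sg \<gamma>] by (simp add: M\<alpha> Tuf)
    finally have "flat s (sharp \<gamma>) = (g \<triangleright> M) \<bullet> (\<gamma> \<triangleleft> T) \<bullet> ((s \<odot> g) \<triangleright> H)"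
      unfolding flat_def using vcomp_assoc[OF H'[OF s] \<gamma>T gM] by simp
    \<comment> \<open>The exchange law moves the unit past \<open>\<gamma>\<close>; it then cancels
      against \<open>M\<close> by the right unit law, which stands in for the triangle identity at
      \<open>f\<close>.\<close>
    also have "\<dots> = (g \<triangleright> M) \<bullet> ((g \<odot> T) \<triangleright> H) \<bullet> \<gamma>"
      using whisker_exchange[OF 1(2) sg H \<gamma>] hcomp_id_right[OF sg \<gamma>] by simp
    also have "\<dots> = ((g \<triangleright> M) \<bullet> (g \<triangleright> (T \<triangleright> H))) \<bullet> \<gamma>"
      using vcomp_assoc[OF \<gamma> gTH gM] lwhisker_comp1[OF 1(2) T g H] by simp
    also have "\<dots> = \<gamma>"
      using lwhisker_vcomp[OF T g TH M] MTH hcomp_id2[OF T g] vcomp_id_left[OF \<gamma>] by simp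
    finally show ?thesis .
  qed
  have sharp_flat: "sharp (flat s \<beta>) = \<beta>"
    if s: "s \<in> hom1 K y y" and \<beta>: "\<beta> \<in> hom2 K (s \<odot> gu) gu" for s \<beta>
  proof -
    have sg: "s \<odot> g \<in> hom1 K x y" and sgu: "s \<odot> gu \<in> hom1 K e y"
      using comp1_closed[OF g s] comp1_closed[OF gu s] .
    have \<beta>f: "\<beta> \<triangleleft> f \<in> hom2 K ((s \<odot> g) \<odot> T) (g \<odot> T)"
      using rwhisker_closed[OF f sgu \<beta>] by (simp add: gum rgT[OF s])
    have \<beta>fu: "(\<beta> \<triangleleft> f) \<triangleleft> u \<in> hom2 K ((s \<odot> g) \<odot> T \<odot> u) (g \<odot> T \<odot> u)"
      using rwhisker_closed[OF u comp1_closed[OF T sg] \<beta>f]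
      by (simp add: gTu comp1_assoc[OF u T sg])
    have sgHu: "((s \<odot> g) \<triangleright> H) \<triangleleft> u = (s \<odot> g) \<triangleright> (H \<triangleleft> u)"
      using lwhisker_rwhisker[OF u 1(2) sg H] .
    have sgHu2: "(s \<odot> g) \<triangleright> (H \<triangleleft> u) \<in> hom2 K (s \<odot> gu) ((s \<odot> g) \<odot> T \<odot> u)"
      using lwhisker_closed[OF u sg Hu] by (simp add: rgu[OF s])
    have sg\<alpha>: "(s \<odot> g) \<triangleright> \<alpha> \<in> hom2 K ((s \<odot> g) \<odot> T \<odot> u) (s \<odot> gu)"
      using lwhisker_closed[OF Tu sg \<alpha>] by (simp add: rgu[OF s])
    \<comment> \<open>Since \<open>\<alpha>\<close> is \<open>u \<triangleright> c\<close>, the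
      counit can be exchanged with \<open>\<beta>\<close>. This brings \<open>\<alpha>\<close> next
      to the unit, where the triangle identity at \<open>u\<close> applies.\<close>
    have "(g \<triangleright> \<alpha>) \<bullet> ((\<beta> \<triangleleft> f) \<triangleleft> u) = (gu \<triangleright> c) \<bullet> (\<beta> \<triangleleft> (f \<odot> u))"
      using lwhisker_comp1[OF fu u g c] rwhisker_comp1[OF u f sgu \<beta>] by (simp add: \<alpha>_def gu_def)
    also have "\<dots> = \<beta> \<bullet> ((s \<odot> gu) \<triangleright> c)"
      using whisker_exchange[OF fu sgu c \<beta>] hcomp_id_right[OF sgu \<beta>] by simp
    also have "\<dots> = \<beta> \<bullet> ((s \<odot> g) \<triangleright> \<alpha>)"
      using lwhisker_comp1[OF fu u sg c] by (simp add: \<alpha>_def rgu[OF s])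
    finally have counit: "(g \<triangleright> \<alpha>) \<bullet> ((\<beta> \<triangleleft> f) \<triangleleft> u) = \<beta> \<bullet> ((s \<odot> g) \<triangleright> \<alpha>)" .
    have "sharp (flat s \<beta>) = (g \<triangleright> \<alpha>) \<bullet> ((\<beta> \<triangleleft> f) \<triangleleft> u) \<bullet> ((s \<odot> g) \<triangleright> (H \<triangleleft> u))"
      unfolding sharp_def flat_def using rwhisker_vcomp[OF u sg H'[OF s] \<beta>f] sgHu by simp
    also have "\<dots> = \<beta> \<bullet> ((s \<odot> g) \<triangleright> \<alpha>) \<bullet> ((s \<odot> g) \<triangleright> (H \<triangleleft> u))"
      using vcomp_assoc[OF sgHu2 \<beta>fu g\<alpha>] vcomp_assoc[OF sgHu2 sg\<alpha> \<beta>] counit by simp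
    also have "\<dots> = \<beta>"
      using lwhisker_vcomp[OF u sg Hu \<alpha>] \<alpha>H hcomp_id2[OF u sg] vcomp_id_right[OF \<beta>]
      by (simp add: rgu[OF s])
    finally show ?thesis .
  qed

  \<comment> \<open>As \<open>\<epsilon>'\<close> is \<open>sharp \<epsilon>\<close>, this is
    naturality of the transposition. The universal property, the unit and the multiplication are all
    transferred through it.\<close>
  have \<epsilon>'_whisker: "\<epsilon>' \<bullet> (\<theta> \<triangleleft> gu) = sharp (\<epsilon> \<bullet> (\<theta> \<triangleleft> g))"
    if s: "s \<in> hom1 K y y" and \<theta>: "\<theta> \<in> hom2 K s r" for s \<theta>
  proof -
    have sg: "s \<odot> g \<in> hom1 K x y" and rg: "r \<odot> g \<in> hom1 K x y"
      using comp1_closed[OF g s] comp1_closed[OF g r] .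
    have \<theta>g: "\<theta> \<triangleleft> g \<in> hom2 K (s \<odot> g) (r \<odot> g)" using rwhisker_closed[OF g s \<theta>] .
    have \<epsilon>u: "\<epsilon> \<triangleleft> u \<in> hom2 K ((r \<odot> g) \<odot> u) (g \<odot> T \<odot> u)"
      using rwhisker_closed[OF u rg \<epsilon>] by (simp add: gTu)
    show ?thesis
      unfolding \<epsilon>'_def sharp_def rwhisker_vcomp[OF u sg \<theta>g \<epsilon>]
      using vcomp_assoc[OF rwhisker_closed[OF u sg \<theta>g] \<epsilon>u g\<alpha>] rwhisker_comp1[OF u g s \<theta>]
      by (simp add: gu_def)
  qed

  \<comment> \<open>The right extension along \<open>gu\<close>\<close>
  have rext: "is_right_extension K e y y gu gu r \<epsilon>'"
    unfolding is_right_extension_def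
  proof (intro conjI ballI)
    show "\<epsilon>' \<in> hom2 K (r \<odot> gu) gu" using sharp[OF r \<epsilon>] by (simp add: \<epsilon>'_def sharp_def)
    fix s \<beta> assume s: "s \<in> hom1 K y y" and \<beta>: "\<beta> \<in> hom2 K (s \<odot> gu) gu"
    \<comment> \<open>Because \<open>sharp\<close> and \<open>flat\<close> are mutually inverse,
      \<open>\<theta>\<close> solves the extension problem for \<open>\<beta>\<close> exactly when
      it solves the original one for \<open>flat s \<beta>\<close>; unique existence carries
      over.\<close>
    have "\<epsilon> \<bullet> (\<theta> \<triangleleft> g) = flat s \<beta> \<longleftrightarrow> \<epsilon>' \<bullet> (\<theta> \<triangleleft> gu) = \<beta>" if \<theta>: "\<theta> \<in> hom2 K s r" for \<theta>
      using \<epsilon>'_whisker[OF s \<theta>] sharp_flat[OF s \<beta>]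
        flat_sharp[OF s vcomp_closed[OF rwhisker_closed[OF g s \<theta>] \<epsilon>]] by metis
    with U[OF s flat[OF s \<beta>]] show "\<exists>!\<theta>. \<theta> \<in> hom2 K s r \<and> \<epsilon>' \<bullet> (\<theta> \<triangleleft> gu) = \<beta>" by metis
  qed (fact gu r)+

  \<comment> \<open>Compatibility with unit and multiplication\<close>
  have \<epsilon>'h: "\<epsilon>' \<bullet> (h \<triangleleft> gu) = \<iota> gu"
  proof -
    have "\<epsilon>' \<bullet> (h \<triangleleft> gu) = (g \<triangleright> \<alpha>) \<bullet> (g \<triangleright> (H \<triangleleft> u))"
      using \<epsilon>'_whisker[OF 1(3) h] eh lwhisker_rwhisker[OF u 1(2) g H] by (simp add: sharp_def)
    also have "\<dots> = \<iota> gu"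
      using lwhisker_vcomp[OF u g Hu \<alpha>] \<alpha>H hcomp_id2[OF u g] by (simp add: gu_def)
    finally show ?thesis .
  qed

  \<comment> \<open>The multiplication equation of a pushforward of the identity monad, with its
    identity factors removed.\<close>
  have \<epsilon>'m: "\<epsilon>' \<bullet> (m \<triangleleft> gu) = \<epsilon>' \<bullet> (r \<triangleright> \<epsilon>')"
  proof -
    have rg: "r \<odot> g \<in> hom1 K x y" and rr: "r \<odot> r \<in> hom1 K y y"
      using comp1_closed[OF g r] comp1_closed[OF r r] .
    have TT: "T \<odot> T \<in> hom1 K x x" and TTu: "T \<odot> T \<odot> u \<in> hom1 K e x"
      using comp1_closed[OF T T] comp1_closed[OF Tu T] .
    have rrg: "r \<odot> r \<odot> g \<in> hom1 K x y" and rgu': "(r \<odot> g) \<odot> u \<in> hom1 K e y"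
      using comp1_closed[OF rg r] comp1_closed[OF u rg] .
    have gTu': "g \<odot> T \<odot> u \<in> hom1 K e y" using comp1_closed[OF Tu g] .
    have r\<epsilon>: "r \<triangleright> \<epsilon> \<in> hom2 K (r \<odot> r \<odot> g) ((r \<odot> g) \<odot> T)"
      using lwhisker_closed[OF rg r \<epsilon>] by (simp add: comp1_assoc[OF T g r])
    have \<epsilon>T: "\<epsilon> \<triangleleft> T \<in> hom2 K ((r \<odot> g) \<odot> T) (g \<odot> T \<odot> T)"
      using rwhisker_closed[OF T rg \<epsilon>] by (simp add: comp1_assoc[OF T T g])
    have gM: "g \<triangleright> M \<in> hom2 K (g \<odot> T \<odot> T) (g \<odot> T)" using lwhisker_closed[OF TT g M] .
    have \<epsilon>u: "\<epsilon> \<triangleleft> u \<in> hom2 K ((r \<odot> g) \<odot> u) (g \<odot> T \<odot> u)"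
      using rwhisker_closed[OF u rg \<epsilon>] by (simp add: gTu)
    have r\<epsilon>u: "r \<triangleright> (\<epsilon> \<triangleleft> u) \<in> hom2 K (r \<odot> (r \<odot> g) \<odot> u) ((r \<odot> g) \<odot> T \<odot> u)"
      using lwhisker_closed[OF rgu' r \<epsilon>u] by (simp add: comp1_assoc[OF Tu g r])
    have \<epsilon>Tu: "\<epsilon> \<triangleleft> (T \<odot> u) \<in> hom2 K ((r \<odot> g) \<odot> T \<odot> u) (g \<odot> T \<odot> T \<odot> u)"
      using rwhisker_closed[OF Tu rg \<epsilon>] by (simp add: comp1_assoc[OF Tu T g])
    have T\<alpha>: "T \<triangleright> \<alpha> \<in> hom2 K (T \<odot> T \<odot> u) (T \<odot> u)" using lwhisker_closed[OF Tu T \<alpha>] .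
    have Mu: "M \<triangleleft> u \<in> hom2 K (T \<odot> T \<odot> u) (T \<odot> u)"
      using rwhisker_closed[OF u TT M] by (simp add: comp1_assoc[OF u T T])
    have gMu: "g \<triangleright> (M \<triangleleft> u) \<in> hom2 K (g \<odot> T \<odot> T \<odot> u) (g \<odot> T \<odot> u)"
      using lwhisker_closed[OF TTu g Mu] .
    have gT\<alpha>: "g \<triangleright> (T \<triangleright> \<alpha>) \<in> hom2 K (g \<odot> T \<odot> T \<odot> u) (g \<odot> T \<odot> u)"
      using lwhisker_closed[OF TTu g T\<alpha>] .
    have rg\<alpha>: "(r \<odot> g) \<triangleright> \<alpha> \<in> hom2 K ((r \<odot> g) \<odot> T \<odot> u) ((r \<odot> g) \<odot> u)"
      using lwhisker_closed[OF Tu rg \<alpha>] .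
    \<comment> \<open>Two successive uses of \<open>\<epsilon>\<close>, moving both copies of
      \<open>r\<close> past \<open>g\<close> to become copies of \<open>T\<close> acting on
      \<open>u\<close>.\<close>
    let ?Z = "(\<epsilon> \<triangleleft> (T \<odot> u)) \<bullet> (r \<triangleright> (\<epsilon> \<triangleleft> u))"
    note Z = vcomp_closed[OF r\<epsilon>u \<epsilon>Tu]
    have "\<epsilon>' \<bullet> (m \<triangleleft> gu) = sharp ((g \<triangleright> M) \<bullet> (\<epsilon> \<triangleleft> T) \<bullet> (r \<triangleright> \<epsilon>))"
      using \<epsilon>'_whisker[OF rr m] em by simp
    also have "\<dots> = (g \<triangleright> \<alpha>) \<bullet> (g \<triangleright> (M \<triangleleft> u)) \<bullet> ?Z"
      unfolding sharp_def rwhisker_vcomp[OF u rrg vcomp_closed[OF r\<epsilon> \<epsilon>T] gM]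
        rwhisker_vcomp[OF u rrg r\<epsilon> \<epsilon>T] lwhisker_rwhisker[OF u TT g M]
        rwhisker_comp1[OF u T rg \<epsilon>] lwhisker_rwhisker[OF u rg r \<epsilon>] ..
    also have "\<dots> = (g \<triangleright> (\<alpha> \<bullet> (M \<triangleleft> u))) \<bullet> ?Z"
      using vcomp_assoc[OF Z gMu g\<alpha>] lwhisker_vcomp[OF TTu g Mu \<alpha>] by simp
    \<comment> \<open>The associativity law of the action replaces one multiplication followed by
      \<open>\<alpha>\<close> with two applications of \<open>\<alpha>\<close>, one for each
      \<open>\<epsilon>'\<close> wanted on the right.\<close>
    also have "\<dots> = (g \<triangleright> \<alpha>) \<bullet> (g \<triangleright> (T \<triangleright> \<alpha>)) \<bullet> ?Z"
      using vcomp_assoc[OF Z gT\<alpha> g\<alpha>] lwhisker_vcomp[OF TTu g T\<alpha> \<alpha>] \<alpha>\<alpha> by simp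
    \<comment> \<open>The inner \<open>\<alpha>\<close> is exchanged with the outer
      \<open>\<epsilon>\<close>, so that it meets the inner \<open>\<epsilon>\<close> and forms
      \<open>r \<triangleright> \<epsilon>'\<close>.\<close>
    also have "(g \<triangleright> (T \<triangleright> \<alpha>)) \<bullet> ?Z = ((\<epsilon> \<triangleleft> u) \<bullet> ((r \<odot> g) \<triangleright> \<alpha>)) \<bullet> (r \<triangleright> (\<epsilon> \<triangleleft> u))"
      using vcomp_assoc[OF r\<epsilon>u \<epsilon>Tu gT\<alpha>] whisker_exchange[OF Tu rg \<alpha> \<epsilon>]
        lwhisker_comp1[OF Tu T g \<alpha>] by simp
    also have "\<dots> = (\<epsilon> \<triangleleft> u) \<bullet> (r \<triangleright> \<epsilon>')"
      unfolding \<epsilon>'_def lwhisker_vcomp[OF rgu' r \<epsilon>u g\<alpha>]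
      using vcomp_assoc[OF r\<epsilon>u rg\<alpha> \<epsilon>u] lwhisker_comp1[OF Tu g r \<alpha>] by simp
    also have "(g \<triangleright> \<alpha>) \<bullet> \<dots> = \<epsilon>' \<bullet> (r \<triangleright> \<epsilon>')"
    proof -
      have "\<epsilon>' \<in> hom2 K ((r \<odot> g) \<odot> u) gu" using vcomp_closed[OF \<epsilon>u g\<alpha>] by (simp add: \<epsilon>'_def)
      from lwhisker_closed[OF rgu' r this]
      have "r \<triangleright> \<epsilon>' \<in> hom2 K (r \<odot> (r \<odot> g) \<odot> u) ((r \<odot> g) \<odot> u)" by (simp add: rgu[OF r])
      from vcomp_assoc[OF this \<epsilon>u g\<alpha>] show ?thesis by (simp add: \<epsilon>'_def)
    qed
    finally show ?thesis .
  qed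

  \<comment> \<open>The pushforward of the identity monad\<close>
  have "\<epsilon>' \<in> hom2 K (r \<odot> gu) gu" "\<epsilon>' \<bullet> (r \<triangleright> \<epsilon>') \<in> hom2 K (r \<odot> r \<odot> gu) gu"
    using rext vcomp_closed[OF lwhisker_closed[OF comp1_closed[OF gu r] r]]
    by (auto simp: is_right_extension_def)
  \<comment> \<open>For the identity monad the multiplication equation contains a whiskering by
    \<open>\<one> e\<close> and a vertical composite with \<open>\<iota> gu\<close>; both are
    absorbed here.\<close>
  then have "\<epsilon>' \<triangleleft> \<one> e = \<epsilon>'" "\<iota> gu \<bullet> \<epsilon>' \<bullet> (r \<triangleright> \<epsilon>') = \<epsilon>' \<bullet> (r \<triangleright> \<epsilon>')"
    using hcomp_id_right[OF comp1_closed[OF gu r]] by (auto intro: vcomp_id_left)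
  then have "is_pushforward_via K e y gu (identity_monad K e) p \<epsilon>'"
    unfolding is_pushforward_via_def
    using is_monad_identity_monad[OF e] gu rext p \<epsilon>'h \<epsilon>'m
    by (simp add: identity_monad_def comp1_id_right[OF gu] hcomp_id2[OF 1(1) gu] defs)
  then show ?thesis by (simp add: gu_def \<epsilon>'_def \<alpha>_def)
qed

end

theorem corollary1p11:
  fixes K :: "('o, 'a, 'c) two_cat"
    and x y xt :: 'o and g ut :: 'a and t p :: "('a, 'c) monad"
  assumes "two_category K"
    and "has_em_objects K"
    and "g \<in> hom1 K x y"
    and "is_monad K x t"
    and "is_pushforward K x y g t p"
    and "is_em_object K x t xt ut"
  shows "is_codensity_monad K xt y (g \<odot>\<^bsub>K\<^esub> ut) p"
proof -
  interpret two_category K by fact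
  obtain \<epsilon> where \<epsilon>: "is_pushforward_via K x y g t p \<epsilon>"
    using assms(5) by (auto simp: is_pushforward_def)
  have u: "ut \<in> hom1 K xt x" using assms(6) by (simp add: is_em_object_def)
  from em_object_adjunction[OF assms(4,6)] obtain f c where
    "f \<in> hom1 K x xt" "c \<in> hom2 K (f \<odot>\<^bsub>K\<^esub> ut) (\<one>\<^bsub>K\<^esub> xt)" "endo t = ut \<odot>\<^bsub>K\<^esub> f"
    "mult t = (ut \<triangleright>\<^bsub>K\<^esub> c) \<triangleleft>\<^bsub>K\<^esub> f" "(ut \<triangleright>\<^bsub>K\<^esub> c) \<bullet>\<^bsub>K\<^esub> (unit t \<triangleleft>\<^bsub>K\<^esub> ut) = \<iota>\<^bsub>K\<^esub> ut"
    by blast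
  \<comment> \<open>The 2-cell exhibiting \<open>p\<close> as the codensity monad is the transpose
    of \<open>\<epsilon>\<close>.\<close>
  from pushforward_via_right_adjoint[OF this(1) u this(2-5) \<epsilon>]
  show ?thesis by (auto simp: is_codensity_monad_def is_pushforward_def)
qed

end
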